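(* Assume that for each $i$, $J_i$ is continuously differentiable and convex in $x_i$ for given $x_{-i}$, that $\mathcal X$ satisfies Slater's condition, that $G$ has full row rank, and that the communication graph $\mathcal G$ is undirected and connected. Consider, with $c>0$, the dynamics $$\dot{\mathbf x}=-\mathcal R^\top\mathbf F(\mathbf x)-\mathcal R^\top G_d^\top\lambda-c\,\mathbf L\mathbf x,\qquad \dot z=L\lambda,$$ $$\lambda=\operatorname*{arg\,min}_{\lambda\ge0}\ \tfrac12\|G_d^\top\lambda\|^2+\lambda^\top\big[G_d\mathbf F(\mathbf x)+cG_d\mathcal R\mathbf L\mathbf x-\alpha(G_d\mathcal R\mathbf x-H_s)+Lz\big]+\tfrac12\lambda^\top L\lambda .$$ Then for any $\alpha>0$ and any feasible initial condition $x(0)=\mathcal R\mathbf x(0)\in\mathcal X$, or equivalently $\mathbf x(0)\in\hat{\mathcal X}$, both sets $\hat{\mathcal X}$ and $\mathcal X$ are forward invariant, i.e. $\mathbf x(t)\in\hat{\mathcal X}$ and $x(t)=\mathcal R\mathbf x(t)\in\mathcal X$ for all $t\ge0$ (for which the solution is defined).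
   Context: There are $N$ players indexed by $\mathcal I=\{1,\dots,N\}$. Player $i$ chooses $x_i\in\mathbb R^{n_i}$; $n=\sum_i n_i$; $x=\mathrm{col}\{x_i\}_{i\in\mathcal I}\in\mathbb R^n$ is the stacked vector and $x_{-i}$ the stacked vector of the decisions of all players other than $i$. Player $i$ has objective $J_i(x_i,x_{-i})$ and local constraint data $g_i\in\mathbb R^{m\times n_i}$, $h_i\in\mathbb R^m$. Put $G=[g_1\ \cdots\ g_N]$, $H=\sum_i h_i$, $\mathcal X=\{x\in\mathbb R^n\mid Gx-H\le 0\}$, $G_d=\mathrm{diag}\{g_i\}_{i\in\mathcal I}$ (block diagonal), $H_s=\mathrm{col}\{h_i\}_{i\in\mathcal I}$. Inequalities between vectors are entrywise. Communication graph: $\mathcal G$ is an undirected weighted graph on $\mathcal I$ with symmetric adjacency matrix $\mathcal A=[a_{ij}]$, $a_{ij}\ge0$, $a_{ii}=0$, $a_{ij}>0$ iff $(i,j)$ is an edge; Laplacian $\mathcal L=\mathrm{diag}\{\mathcal A\mathbf 1_N\}-\mathcal A$; $L=\mathcal L\otimes I_m$, $\mathbf L=\mathcal L\otimes I_n$. The variables $z=\mathrm{col}\{z_i\}$, $\lambda=\mathrm{col}\{\lambda_i\}$ have $z_i,\lambda_i\in\mathbb R^m$. Partial information: player $i$ keeps an augmented vector $\mathbf x_i=\mathrm{col}\{\mathbf x_i^1,\dots,\mathbf x_i^{i-1},x_i,\mathbf x_i^{i+1},\dots,\mathbf x_i^N\}\in\mathbb R^n$, where $\mathbf x_i^j\in\mathbb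 R^{n_j}$ is its estimate of player $j$'s decision; $\mathbf x=\mathrm{col}\{\mathbf x_i\}_{i\in\mathcal I}\in\mathbb R^{Nn}$. $\mathcal R_i=[\,0_{n_i\times\sum_{j<i}n_j}\ \ I_{n_i}\ \ 0_{n_i\times\sum_{j>i}n_j}\,]$ (so $x_i=\mathcal R_i\mathbf x_i$), $\mathcal R=\mathrm{diag}\{\mathcal R_i\}_{i\in\mathcal I}$ (so $x=\mathcal R\mathbf x$). $\hat{\mathcal X}=\{\mathbf x\in\mathbb R^{Nn}\mid G\mathcal R\mathbf x\le H\}$. Extended pseudo-gradient: $\mathbf F(\mathbf x)=\mathrm{col}\{\nabla_{x_i}J_i(\mathbf x_i)\}_{i\in\mathcal I}$, where $\nabla_{x_i}J_i(\mathbf x_i)$ is the partial gradient of $J_i$ in the $i$-th block evaluated at the profile $\mathbf x_i$. *)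

theory Defs
  imports "HOL-Analysis.Analysis"
begin

text \<open>
  Conventions. Players are the elements of a finite type \<open>'p\<close>. All scalar decision variables of
  all players are indexed by one finite type \<open>'k\<close>, and \<open>own k\<close> is the player who owns variable \<open>k\<close>.
  So \<open>n\<close> is \<open>CARD('k)\<close>, \<open>n\<^sub>i\<close> is \<open>card {k. own k = i}\<close>, the stacked profile \<open>x\<close> is a
  \<open>real^'k\<close> and its block \<open>x\<^sub>i\<close> consists of the entries \<open>x $ k\<close> with \<open>own k = i\<close>. Coupling
  constraints are indexed by \<open>'m\<close>. A stack of \<open>N\<close> vectors indexed by \<open>'a\<close> is a
  \<open>real^('p \<times> 'a)\<close>. Block \<open>g\<^sub>i\<close> is stored as a full-width matrix \<open>g i\<close> of which only
  the columns owned by \<open>i\<close> are ever read. Inequalities between vectors are entrywise, as in the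
  library order on \<open>real^'m\<close>.
\<close>

subsection \<open>Matrices\<close>

definition diag_matrix :: "real^'p::finite \<Rightarrow> real^'p^'p" where
  "diag_matrix v = (\<chi> i j. if i = j then v $ i else 0)"

definition kron :: "real^'b::finite^'a::finite \<Rightarrow> real^'d::finite^'c::finite \<Rightarrow> real^('b \<times> 'd)^('a \<times> 'c)" where
  "kron A B = (\<chi> p q. A $ fst p $ fst q * B $ snd p $ snd q)"

text \<open>\<open>G = [g\<^sub>1 \<dots> g\<^sub>N]\<close>\<close>
definition G_mat :: "('k::finite \<Rightarrow> 'p::finite) \<Rightarrow> ('p \<Rightarrow> real^'k^'m::finite) \<Rightarrow> real^'k^'m" where
  "G_mat own g = (\<chi> r k. g (own k) $ r $ k)"

definition H_vec :: "('p::finite \<Rightarrow> real^'m::finite) \<Rightarrow> real^'m" where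
  "H_vec h = (\<Sum>i\<in>UNIV. h i)"

text \<open>\<open>G\<^sub>d = diag{g\<^sub>i}\<close>: row \<open>(i, r)\<close> is row \<open>r\<close> of \<open>g\<^sub>i\<close>, supported on the columns of block \<open>i\<close>.\<close>
definition Gd_mat :: "('k::finite \<Rightarrow> 'p::finite) \<Rightarrow> ('p \<Rightarrow> real^'k^'m::finite) \<Rightarrow> real^'k^('p \<times> 'm)" where
  "Gd_mat own g = (\<chi> p k. if own k = fst p then g (fst p) $ snd p $ k else 0)"

definition Hs_vec :: "('p::finite \<Rightarrow> real^'m::finite) \<Rightarrow> real^('p \<times> 'm)" where
  "Hs_vec h = (\<chi> p. h (fst p) $ snd p)"

text \<open>
  \<open>diag{R\<^sub>i}\<close>: its rows, the stacked rows of the selections \<open>R\<^sub>i\<close>, are indexed by \<open>'k\<close>; row \<open>k\<close>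
  picks entry \<open>k\<close> of the augmented vector kept by the owner of \<open>k\<close>.
\<close>
definition R_mat :: "('k::finite \<Rightarrow> 'p::finite) \<Rightarrow> real^('p \<times> 'k)^'k" where
  "R_mat own = (\<chi> k q. if q = (own k, k) then 1 else 0)"

text \<open>The augmented vector kept by player \<open>i\<close>.\<close>
definition player_block :: "'p::finite \<Rightarrow> real^('p \<times> 'k::finite) \<Rightarrow> real^'k" where
  "player_block i X = (\<chi> k. X $ (i, k))"

subsection \<open>Communication graph\<close>

definition undirected_weighted_adjacency :: "real^'p::finite^'p \<Rightarrow> bool" where
  "undirected_weighted_adjacency A \<longleftrightarrow>
     transpose A = A \<and> (\<forall>i j. 0 \<le> A $ i $ j) \<and> (\<forall>i. A $ i $ i = 0)"

definition graph_edges :: "real^'p::finite^'p \<Rightarrow> ('p \<times> 'p) set" where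
  "graph_edges A = {(i, j). 0 < A $ i $ j}"

definition graph_connected :: "real^'p::finite^'p \<Rightarrow> bool" where
  "graph_connected A \<longleftrightarrow> (\<forall>i j. (i, j) \<in> (graph_edges A)\<^sup>*)"

text \<open>Here \<open>1\<close> is the all-ones vector.\<close>
definition laplacian :: "real^'p::finite^'p \<Rightarrow> real^'p^'p" where
  "laplacian A = diag_matrix (A *v 1) - A"

definition L_dual :: "real^'p::finite^'p \<Rightarrow> real^('p \<times> 'm::finite)^('p \<times> 'm)" where
  "L_dual A = kron (laplacian A) (mat 1)"

definition L_primal :: "real^'p::finite^'p \<Rightarrow> real^('p \<times> 'k::finite)^('p \<times> 'k)" where
  "L_primal A = kron (laplacian A) (mat 1)"

subsection \<open>Objectives\<close>

text \<open>The profile \<open>x\<close> with the decision of player \<open>i\<close> replaced by block \<open>i\<close> of \<open>u\<close>.\<close>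
definition replace_block :: "('k::finite \<Rightarrow> 'p::finite) \<Rightarrow> 'p \<Rightarrow> real^'k \<Rightarrow> real^'k \<Rightarrow> real^'k" where
  "replace_block own i u x = (\<chi> k. if own k = i then u $ k else x $ k)"

text \<open>
  The partial gradient of \<open>f\<close> in block \<open>i\<close> at \<open>x\<close>, padded with zeros outside block \<open>i\<close>:
  the differentiated map does not depend on the entries of \<open>u\<close> outside block \<open>i\<close>.
\<close>
definition partial_grad :: "('k::finite \<Rightarrow> 'p::finite) \<Rightarrow> 'p \<Rightarrow> (real^'k \<Rightarrow> real) \<Rightarrow> real^'k \<Rightarrow> real^'k" where
  "partial_grad own i f x = (THE D. GDERIV (\<lambda>u. f (replace_block own i u x)) x :> D)"

text \<open>
  Continuous differentiability in block \<open>i\<close> for each fixed choice of the other blocks; joint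
  continuity of the partial gradient is not required.
\<close>
definition C1_in_block :: "('k::finite \<Rightarrow> 'p::finite) \<Rightarrow> 'p \<Rightarrow> (real^'k \<Rightarrow> real) \<Rightarrow> bool" where
  "C1_in_block own i f \<longleftrightarrow>
     (\<forall>x. (\<forall>u. (\<lambda>v. f (replace_block own i v x)) differentiable (at u)) \<and>
          continuous_on UNIV (\<lambda>u. partial_grad own i f (replace_block own i u x)))"

definition convex_in_block :: "('k::finite \<Rightarrow> 'p::finite) \<Rightarrow> 'p \<Rightarrow> (real^'k \<Rightarrow> real) \<Rightarrow> bool" where
  "convex_in_block own i f \<longleftrightarrow> (\<forall>x. convex_on UNIV (\<lambda>u. f (replace_block own i u x)))"

definition ext_pseudo_grad ::
  "('k::finite \<Rightarrow> 'p::finite) \<Rightarrow> ('p \<Rightarrow> real^'k \<Rightarrow> real) \<Rightarrow> real^('p \<times> 'k) \<Rightarrow> real^'k" where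
  "ext_pseudo_grad own J X =
     (\<chi> k. partial_grad own (own k) (J (own k)) (player_block (own k) X) $ k)"

subsection \<open>Feasible sets\<close>

definition feasible_set ::
  "('k::finite \<Rightarrow> 'p::finite) \<Rightarrow> ('p \<Rightarrow> real^'k^'m::finite) \<Rightarrow> ('p \<Rightarrow> real^'m) \<Rightarrow> (real^'k) set" where
  "feasible_set own g h = {x. G_mat own g *v x - H_vec h \<le> 0}"

definition ext_feasible_set ::
  "('k::finite \<Rightarrow> 'p::finite) \<Rightarrow> ('p \<Rightarrow> real^'k^'m::finite) \<Rightarrow> ('p \<Rightarrow> real^'m) \<Rightarrow> (real^('p \<times> 'k)) set" where
  "ext_feasible_set own g h = {X. G_mat own g *v (R_mat own *v X) \<le> H_vec h}"

text \<open>
  The strict inequality is spelled out entrywise, since \<open><\<close> on \<open>real^'m\<close> only means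
  \<open>\<le>\<close> with at least one strict entry.
\<close>
definition slater ::
  "('k::finite \<Rightarrow> 'p::finite) \<Rightarrow> ('p \<Rightarrow> real^'k^'m::finite) \<Rightarrow> ('p \<Rightarrow> real^'m) \<Rightarrow> bool" where
  "slater own g h \<longleftrightarrow> (\<exists>x. \<forall>r. (G_mat own g *v x - H_vec h) $ r < 0)"

subsection \<open>Dynamics\<close>

definition qp_objective ::
  "('k::finite \<Rightarrow> 'p::finite) \<Rightarrow> ('p \<Rightarrow> real^'k^'m::finite) \<Rightarrow> ('p \<Rightarrow> real^'m) \<Rightarrow> ('p \<Rightarrow> real^'k \<Rightarrow> real) \<Rightarrow>
   real^'p^'p \<Rightarrow> real \<Rightarrow> real \<Rightarrow> real^('p \<times> 'k) \<Rightarrow> real^('p \<times> 'm) \<Rightarrow> real^('p \<times> 'm) \<Rightarrow> real" where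
  "qp_objective own g h J A c \<alpha> X z l =
     1/2 * (norm (transpose (Gd_mat own g) *v l))\<^sup>2
     + l \<bullet> (Gd_mat own g *v ext_pseudo_grad own J X
            + c *\<^sub>R (Gd_mat own g *v (R_mat own *v (L_primal A *v X)))
            - \<alpha> *\<^sub>R (Gd_mat own g *v (R_mat own *v X) - Hs_vec h)
            + L_dual A *v z)
     + 1/2 * (l \<bullet> (L_dual A *v l))"

text \<open>
  \<open>(X, z, lam)\<close> is a classical solution on the time interval \<open>I\<close>, with one-sided derivatives
  at end points of \<open>I\<close>.
\<close>
definition solution_on ::
  "('k::finite \<Rightarrow> 'p::finite) \<Rightarrow> ('p \<Rightarrow> real^'k^'m::finite) \<Rightarrow> ('p \<Rightarrow> real^'m) \<Rightarrow> ('p \<Rightarrow> real^'k \<Rightarrow> real) \<Rightarrow>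
   real^'p^'p \<Rightarrow> real \<Rightarrow> real \<Rightarrow> real set \<Rightarrow>
   (real \<Rightarrow> real^('p \<times> 'k)) \<Rightarrow> (real \<Rightarrow> real^('p \<times> 'm)) \<Rightarrow> (real \<Rightarrow> real^('p \<times> 'm)) \<Rightarrow> bool" where
  "solution_on own g h J A c \<alpha> I X z lam \<longleftrightarrow>
     (\<forall>t\<in>I.
        (X has_vector_derivative
           (- (transpose (R_mat own) *v ext_pseudo_grad own J (X t))
            - transpose (R_mat own) *v (transpose (Gd_mat own g) *v lam t)
            - c *\<^sub>R (L_primal A *v X t))) (at t within I) \<and>
        (z has_vector_derivative (L_dual A *v lam t)) (at t within I) \<and>
        is_arg_min (qp_objective own g h J A c \<alpha> (X t) (z t)) (\<lambda>l. 0 \<le> l) (lam t))"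

end

theory Submission
  imports Defs
begin

text \<open>
  The vector \<open>d = 1 \<otimes> e\<^sub>r\<close> is nonnegative, is annihilated by the Laplacian
  from both sides, and satisfies \<open>G\<^sub>d\<^sup>T d = G\<^sup>T e\<^sub>r\<close>.
  Moving from the minimiser \<open>\<lambda>\<close> in the direction \<open>d\<close> cannot decrease the
  objective, and this first-order condition says exactly that \<open>y = (G x - H)\<^sub>r\<close>
  satisfies \<open>y' \<le> - \<alpha> y\<close> along the dynamics. Hence \<open>y(t) exp (\<alpha> t)\<close> is
  nonincreasing.
\<close>

text \<open>The integrating factor \<open>exp (\<alpha> * s)\<close> turns the differential
  inequality into a sign condition on a derivative. The mean value theorem is used instead of
  integration because \<open>y'\<close> carries no continuity or integrability: in the application
  it involves the minimiser, which may jump in time.\<close>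

lemma gronwall_nonpos:
  fixes y y' :: "real \<Rightarrow> real"
  assumes I: "is_interval I" "0 \<in> I" "t \<in> I" "0 \<le> t"
    and deriv: "\<And>s. s \<in> I \<Longrightarrow> (y has_vector_derivative y' s) (at s within I)"
    and le: "\<And>s. s \<in> I \<Longrightarrow> y' s \<le> - \<alpha> * y s"
    and init: "y 0 \<le> 0"
  shows "y t \<le> 0"
proof -
  have sub: "{0..t} \<subseteq> I"
    using I by (meson atLeastAtMost_iff mem_is_interval_1_I subsetI)
  let ?D = "\<lambda>s. y' s * exp (\<alpha> * s) + \<alpha> * exp (\<alpha> * s) * y s"
  have "((\<lambda>s. y s * exp (\<alpha> * s)) has_derivative (*) (?D s)) (at s within {0..t})"
    if "s \<in> {0..t}" for s
  proof -
    have "(y has_real_derivative y' s) (at s within {0..t})"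
      using has_vector_derivative_within_subset[OF deriv sub] sub that
      by (auto simp: has_real_derivative_iff_has_vector_derivative)
    then have "((\<lambda>s. y s * exp (\<alpha> * s)) has_real_derivative ?D s) (at s within {0..t})"
      by (auto intro!: derivative_eq_intros)
    then show ?thesis
      by (simp add: has_field_derivative_def)
  qed
  from mvt_very_simple[OF \<open>0 \<le> t\<close> this]
  obtain s where s: "s \<in> {0..t}" and eq: "y t * exp (\<alpha> * t) - y 0 * exp (\<alpha> * 0) = ?D s * (t - 0)"
    by auto
  have "?D s = exp (\<alpha> * s) * (y' s + \<alpha> * y s)"
    by (simp add: algebra_simps)
  also have "\<dots> \<le> 0"
    using le[of s] s sub by (intro mult_nonneg_nonpos) auto
  finally have "?D s * (t - 0) \<le> 0"
    using \<open>0 \<le> t\<close> by (intro mult_nonpos_nonneg) auto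
  with eq init have "y t * exp (\<alpha> * t) \<le> 0"
    by simp
  then show ?thesis
    by (simp add: mult_le_0_iff)
qed

text \<open>Divide by \<open>s\<close> and let \<open>s\<close> tend to 0 from the right.\<close>

lemma linear_coeff_nonneg:
  fixes a b :: real
  assumes "\<And>s. 0 < s \<Longrightarrow> 0 \<le> s * a + s\<^sup>2 * b"
  shows "0 \<le> a"
proof (rule tendsto_lowerbound)
  show "((\<lambda>s. a + s * b) \<longlongrightarrow> a) (at_right 0)"
    by (auto intro!: tendsto_eq_intros)
  have "0 \<le> a + s * b" if "0 < s" for s
  proof -
    have "s * a + s\<^sup>2 * b = s * (a + s * b)"
      by (simp add: power2_eq_square algebra_simps)
    then show ?thesis
      using assms[OF that] that by (simp add: zero_le_mult_iff)
  qed
  then show "\<forall>\<^sub>F s in at_right 0. 0 \<le> a + s * b"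
    by (simp add: eventually_at_filter)
qed simp

text \<open>Along the feasible ray \<open>l + s *\<^sub>R d\<close> the objective is a quadratic
  polynomial in \<open>s\<close>. Since \<open>L\<close> kills \<open>d\<close> from both sides, the
  term in \<open>L\<close> is constant along the ray, and the coefficient of \<open>s\<close> is the
  asserted expression.\<close>

lemma qp_first_order:
  fixes B :: "real^'a::finite^'b::finite" and L :: "real^'b^'b"
  assumes min: "is_arg_min (\<lambda>l. 1/2 * (norm (transpose B *v l))\<^sup>2 + l \<bullet> b + 1/2 * (l \<bullet> (L *v l)))
      (\<lambda>l. 0 \<le> l) l"
    and d: "0 \<le> d" "L *v d = 0" "transpose L *v d = 0"
  shows "0 \<le> (transpose B *v d) \<bullet> (transpose B *v l) + d \<bullet> b"
proof (rule linear_coeff_nonneg)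
  fix s :: real assume "0 < s"
  let ?q = "\<lambda>l. 1/2 * (norm (transpose B *v l))\<^sup>2 + l \<bullet> b + 1/2 * (l \<bullet> (L *v l))"
  \<comment> \<open>This removes the cross term with \<open>d\<close> on the left of
    \<open>L\<close>; the one with \<open>d\<close> on the right vanishes by
    \<open>d(2)\<close>.\<close>
  have dL: "d \<bullet> (L *v u) = 0" for u
    by (simp add: d(3) flip: dot_lmul_matrix transpose_matrix_vector)
  have norm_sq: "(norm (u + s *\<^sub>R v))\<^sup>2 = (norm u)\<^sup>2 + 2 * s * (v \<bullet> u) + s\<^sup>2 * (norm v)\<^sup>2"
    for u v :: "real^'a"
    unfolding power2_norm_eq_inner
    by (simp add: inner_add_left inner_add_right inner_commute power2_eq_square algebra_simps
        del: dot_square_norm)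
  have "0 \<le> l" using min by (simp add: is_arg_min_def)
  with d(1) \<open>0 < s\<close> have "0 \<le> l + s *\<^sub>R d"
    by (simp add: less_eq_vec_def)
  with min have "?q l \<le> ?q (l + s *\<^sub>R d)"
    unfolding is_arg_min_def by (meson not_less)
  also have "?q (l + s *\<^sub>R d) = ?q l
      + s * ((transpose B *v d) \<bullet> (transpose B *v l) + d \<bullet> b)
      + s\<^sup>2 * (1/2 * (norm (transpose B *v d))\<^sup>2)"
    unfolding matrix_vector_right_distrib matrix_vector_mult_scaleR norm_sq
    by (simp add: d(2) dL inner_add_left inner_commute algebra_simps del: transpose_matrix_vector)
  finally show "0 \<le> s * ((transpose B *v d) \<bullet> (transpose B *v l) + d \<bullet> b)
      + s\<^sup>2 * (1/2 * (norm (transpose B *v d))\<^sup>2)"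
    by simp
qed

text \<open>Pairing with this vector adds up the local \<open>r\<close>-th entries of all players,
  which turns the distributed data into row \<open>r\<close> of the coupling constraint.\<close>

definition ones_kron_axis :: "'m::finite \<Rightarrow> real^('p::finite \<times> 'm)" where
  "ones_kron_axis r = (\<chi> p. if snd p = r then 1 else 0)"

lemma sum_prod_snd_eq:
  fixes f :: "'p::finite \<times> 'm::finite \<Rightarrow> real"
  shows "(\<Sum>p\<in>UNIV. if snd p = r then f p else 0) = (\<Sum>i\<in>UNIV. f (i, r))"
proof -
  have "(\<Sum>p\<in>UNIV. if snd p = r then f p else 0)
      = (\<Sum>i\<in>UNIV. \<Sum>s\<in>UNIV. if s = r then f (i, s) else 0)"
    by (simp only: sum.cartesian_product UNIV_Times_UNIV case_prod_unfold prod.collapse)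
  then show ?thesis by simp
qed

lemma inner_ones_kron_axis: "ones_kron_axis r \<bullet> v = (\<Sum>i\<in>UNIV. v $ (i, r))"
  by (simp add: ones_kron_axis_def inner_vec_def if_distrib[where f="\<lambda>x. x * _"] sum_prod_snd_eq
      cong: if_cong)

lemma mult_ones_kron_axis: "(M *v ones_kron_axis r) $ p = (\<Sum>i\<in>UNIV. M $ p $ (i, r))"
  by (simp add: ones_kron_axis_def matrix_vector_mult_def if_distrib[where f="\<lambda>x. _ * x"] sum_prod_snd_eq
      cong: if_cong)

lemma laplacian_row_sum: "(\<Sum>j\<in>UNIV. laplacian A $ i $ j) = 0"
  by (simp add: laplacian_def diag_matrix_def sum_subtractf matrix_vector_mult_def)

lemma transpose_laplacian:
  assumes "transpose A = A"
  shows "transpose (laplacian A) = laplacian A"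
proof -
  have "A $ i $ j = A $ j $ i" for i j
    using arg_cong[OF assms, of "\<lambda>M. M $ j $ i"] by (simp add: transpose_def)
  then show ?thesis
    by (simp add: laplacian_def diag_matrix_def transpose_def vec_eq_iff)
qed

lemma transpose_L_dual:
  assumes "transpose A = A"
  shows "transpose (L_dual A) = L_dual A"
proof -
  have "laplacian A $ i $ j = laplacian A $ j $ i" for i j
    using arg_cong[OF transpose_laplacian[OF assms], of "\<lambda>M. M $ j $ i"]
    by (simp add: transpose_def)
  then show ?thesis
    by (simp add: L_dual_def kron_def mat_def transpose_def vec_eq_iff)
qed

text \<open>All players hold the same block here, and the rows of a Laplacian sum to zero.\<close>

lemma L_dual_ones_kron_axis: "L_dual A *v ones_kron_axis r = 0"
  by (simp add: vec_eq_iff mult_ones_kron_axis L_dual_def kron_def laplacian_row_sum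
      flip: sum_distrib_right)

text \<open>Column \<open>k\<close> of \<open>Gd_mat\<close> is supported on the rows of the owner
  of \<open>k\<close>, so summing over players leaves only the owner's coefficient, which is the
  entry of \<open>G_mat\<close>.\<close>

lemma transpose_Gd_ones_kron_axis:
  "transpose (Gd_mat own g) *v ones_kron_axis r = row r (G_mat own g)"
  by (simp add: vec_eq_iff mult_ones_kron_axis Gd_mat_def G_mat_def transpose_def row_def)

lemma ones_kron_axis_inner_Gd:
  "ones_kron_axis r \<bullet> (Gd_mat own g *v u) = row r (G_mat own g) \<bullet> u"
  by (simp flip: dot_lmul_matrix transpose_Gd_ones_kron_axis)

text \<open>The rows of \<open>R_mat\<close> are distinct unit vectors, hence orthonormal.\<close>

lemma R_mat_mult_transpose: "R_mat own *v (transpose (R_mat own) *v u) = u"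
proof -
  have "R_mat own ** transpose (R_mat own) = mat 1"
    by (simp add: vec_eq_iff matrix_matrix_mult_def R_mat_def transpose_def mat_def
        if_distrib[where f="\<lambda>x. x * _"] cong: if_cong)
  then show ?thesis
    by (simp add: matrix_vector_mul_assoc del: transpose_matrix_vector)
qed

lemma feasible_set_iff:
  "x \<in> feasible_set own g h \<longleftrightarrow> (\<forall>r. row r (G_mat own g) \<bullet> x - H_vec h $ r \<le> 0)"
  by (simp add: feasible_set_def less_eq_vec_def matrix_vector_mul_component row_def)

lemma ext_feasible_set_iff:
  "X \<in> ext_feasible_set own g h \<longleftrightarrow> R_mat own *v X \<in> feasible_set own g h"
  by (simp add: feasible_set_def ext_feasible_set_def less_eq_vec_def)

text \<open>Applying \<open>R_mat\<close> to the vector field cancels the transposes in front of the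
  gradient and the multiplier. Up to sign, the result paired with row \<open>r\<close> consists of
  the gradient, multiplier and consensus terms of the first-order condition; what remains there is
  the term in \<alpha>.\<close>

lemma constraint_derivative_bound:
  assumes sym: "transpose A = A"
    and min: "is_arg_min (qp_objective own g h J A c \<alpha> X z) (\<lambda>l. 0 \<le> l) l"
  shows "row r (G_mat own g) \<bullet> (R_mat own *v
           (- (transpose (R_mat own) *v ext_pseudo_grad own J X)
            - transpose (R_mat own) *v (transpose (Gd_mat own g) *v l)
            - c *\<^sub>R (L_primal A *v X)))
         \<le> - \<alpha> * (row r (G_mat own g) \<bullet> (R_mat own *v X) - H_vec h $ r)"
proof -
  let ?d = "ones_kron_axis r"
  \<comment> \<open>By symmetry \<open>L_dual A\<close> moves onto \<open>?d\<close>, so the state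
    \<open>z\<close> drops out of the bound.\<close>
  have "?d \<bullet> (L_dual A *v z) = 0"
    by (simp add: L_dual_ones_kron_axis transpose_L_dual[OF sym]
        flip: dot_lmul_matrix transpose_matrix_vector)
  moreover have "?d \<bullet> Hs_vec h = H_vec h $ r"
    by (simp add: inner_ones_kron_axis Hs_vec_def H_vec_def)
  moreover have "0 \<le> ?d"
    by (simp add: less_eq_vec_def ones_kron_axis_def)
  ultimately show ?thesis
    using qp_first_order[OF min[unfolded qp_objective_def], of ?d]
    by (simp add: L_dual_ones_kron_axis transpose_L_dual[OF sym] transpose_Gd_ones_kron_axis
        ones_kron_axis_inner_Gd R_mat_mult_transpose matrix_vector_mult_diff_distrib
        matrix_vector_mult_scaleR inner_add_right inner_diff_right
        linear_neg[OF matrix_vector_mul_linear] algebra_simps del: transpose_matrix_vector)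
qed

theorem lemma4p5:
  fixes own :: "'k::finite \<Rightarrow> 'p::finite"
    and g :: "'p \<Rightarrow> real^'k^'m::finite"
    and h :: "'p \<Rightarrow> real^'m"
    and J :: "'p \<Rightarrow> real^'k \<Rightarrow> real"
    and A :: "real^'p^'p"
    and c \<alpha> :: real
    and I :: "real set"
    and X :: "real \<Rightarrow> real^('p \<times> 'k)"
    and z lam :: "real \<Rightarrow> real^('p \<times> 'm)"
  assumes "\<And>i. C1_in_block own i (J i)"
    and "\<And>i. convex_in_block own i (J i)"
    and "slater own g h"
    and "rank (G_mat own g) = CARD('m)"
    and "undirected_weighted_adjacency A"
    and "graph_connected A"
    and "c > 0"
    and "\<alpha> > 0"
    and "is_interval I" and "0 \<in> I" and "I \<subseteq> {0..}"
    and "solution_on own g h J A c \<alpha> I X z lam"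
  shows "(R_mat own *v X 0 \<in> feasible_set own g h \<longleftrightarrow> X 0 \<in> ext_feasible_set own g h) \<and>
         (R_mat own *v X 0 \<in> feasible_set own g h \<longrightarrow>
           (\<forall>t\<in>I. X t \<in> ext_feasible_set own g h \<and> R_mat own *v X t \<in> feasible_set own g h))"
proof -
  have sym: "transpose A = A"
    using assms(5) by (simp add: undirected_weighted_adjacency_def)
  \<comment> \<open>By \<open>ext_feasible_set_iff\<close> the extended set is the preimage of the
    feasible set under \<open>R_mat\<close>, so this one invariance gives every claim.\<close>
  have "R_mat own *v X t \<in> feasible_set own g h"
    if init: "R_mat own *v X 0 \<in> feasible_set own g h" and t: "t \<in> I" for t
    unfolding feasible_set_iff
  proof
    fix r
    let ?y = "\<lambda>x. row r (G_mat own g) \<bullet> (R_mat own *v x)"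
    let ?X' = "\<lambda>s. - (transpose (R_mat own) *v ext_pseudo_grad own J (X s))
            - transpose (R_mat own) *v (transpose (Gd_mat own g) *v lam s)
            - c *\<^sub>R (L_primal A *v X s)"
    show "?y (X t) - H_vec h $ r \<le> 0"
    proof (rule gronwall_nonpos[where I = I and y = "\<lambda>s. ?y (X s) - H_vec h $ r"
          and y' = "\<lambda>s. ?y (?X' s)" and \<alpha> = \<alpha>])
      show "0 \<le> t" using t \<open>I \<subseteq> {0..}\<close> by auto
      show "?y (X 0) - H_vec h $ r \<le> 0"
        using init by (simp add: feasible_set_iff)
      fix s assume s: "s \<in> I"
      \<comment> \<open>The constraint value is linear in the state, so its derivative is
        \<open>?y\<close> applied to the vector field.\<close>
      have "bounded_linear ?y"
        by (intro bounded_linear_compose[OF bounded_linear_inner_right]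
            matrix_vector_mul_bounded_linear)
      moreover have "(X has_vector_derivative ?X' s) (at s within I)"
        using assms(12) s by (simp add: solution_on_def)
      ultimately have "((\<lambda>s. ?y (X s)) has_vector_derivative ?y (?X' s)) (at s within I)"
        by (rule bounded_linear.has_vector_derivative)
      then show "((\<lambda>s. ?y (X s) - H_vec h $ r) has_vector_derivative ?y (?X' s)) (at s within I)"
        by (simp only: has_vector_derivative_diff_const)
      show "?y (?X' s) \<le> - \<alpha> * (?y (X s) - H_vec h $ r)"
        using assms(12) s constraint_derivative_bound[OF sym]
        unfolding solution_on_def by blast
    qed (use t assms(9,10) in auto)
  qed
  then show ?thesis
    by (simp add: ext_feasible_set_iff)
qed

end
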